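(* Let $\epsilon>0$ and $T>0$. Let $C=C(\mathcal D,\mathcal D_0,b_1,b_2,b_3)>0$ be the constant of the truncated controllability property (TC) described in the context, $R=e^{-C/T}$ and $\delta=e^{-2C/T}\sqrt{\epsilon}$. Then, for every initial data $(y_0,z_0)\in L^2(\Omega,\mathcal F_0;H^2(\mathcal D)\cap H_0^1(\mathcal D))\times L^2(\Omega,\mathcal F_0;H_0^1(\mathcal D))$ verifying $$ \|(y_0,z_0)\|_{L^2(\Omega,\mathcal F_0;(H^2(\mathcal D)\cap H_0^1(\mathcal D))\times H_0^1(\mathcal D))}\le\delta, $$ there exists $h\in L^2_{\mathcal F}(0,T;L^2(\mathcal D_0))$ such that the solution $(y,z)\in L^2_{\mathcal F}(\Omega;C([0,T];H^2(\mathcal D)))\times L^2_{\mathcal F}(\Omega;C([0,T];H^1_0(\mathcal D)))$ of $$ \begin{cases} \mathrm{d}y+(y_{xxxx}+f_R(y,y_x))\,\mathrm{d}t=\chi_{\mathcal D_0}h\,\mathrm{d}t+(b_1y+ b_2 z)\,\mathrm{d}W(t) &\text{in }Q, \\ \mathrm{d}z- z_{xx}\,\mathrm{d}t=y\,\mathrm{d}t+b_3z\,\mathrm{d}W(t) &\text{in }Q, \\ y=y_{xx}=0 &\text{on }\Sigma, \\ z=0 &\text{on }\Sigma, \\ y(0)=y_0, \quad z(0)=z_0 &\text{in } \mathcal D, \end{cases} $$ satisfies $$ y(T,\cdot)=0\ \text{ in }\mathcal D,\ \text{a.s.} \qquad\text{and}\qquad \mathbb P\Big(\sup_{t\in[0,T]}\|(y,z)\|_{X_t}\le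 R\Big)\ge 1-\epsilon . $$
   Context: $\mathcal D=(0,1)$, $\mathcal D_0$ is a nonempty open subset of $\mathcal D$, $\chi_{\mathcal D_0}$ its indicator function, $Q=\mathcal D\times(0,T)$, $\Sigma=\{0,1\}\times(0,T)$. $(\Omega,\mathcal F,\{\mathcal F_t\}_{t\ge0},\mathbb P)$ is a complete filtered probability space carrying a one-dimensional standard Brownian motion $W$, with $\{\mathcal F_t\}$ its natural filtration augmented by all $\mathbb P$-null sets. $L^p_{\mathcal F}(0,T;X)$ is the space of $X$-valued $\mathcal F_t$-adapted processes in $L^p([0,T]\times\Omega;X)$; $L^2_{\mathcal F}(\Omega;C([0,T];X))$ is the space of $X$-valued adapted continuous processes $\phi$ with $\mathbb E\|\phi\|^2_{C([0,T];X)}<\infty$; $L^2(\Omega,\mathcal F_0;X)$ is the space of $\mathcal F_0$-measurable square-integrable $X$-valued random variables. The coefficients satisfy $b_i=b_i(t)\in L^\infty_{\mathcal F}(0,T;\mathbb R)$, $i=1,2,3$. Weight: $\hat\rho(t)=\exp\left(-\frac{M\zeta}{(\mathsf Q-1)(T-t)}\right)$, $t\in[0,T)$, where $\mathsf Q\in(1,\sqrt2)$, $P>\mathsf Q^2/(2-\mathsf Q^2)$, $\frac{(1+P)\mathsf Q^2}{2}<\zeta<P$ are fixed numbers and $M\ge C_0$ is fixed, where $C_0=C_0(\mathcal D,\mathcal D_0,b_1,b_2,b_3)>0$ is a constant such that for every time horizon $T>0$ and every initial data in $L^2(\Omega,\mathcal F_0;L^2(\mathcal D)^2)$ the system of the claim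 with $f_R$ replaced by $0$ can be driven to $y(T)=z(T)=0$ a.s. by a control $h$ with $\mathbb E\int_0^T\int_{\mathcal D_0}|h|^2\,\mathrm{d}x\,\mathrm{d}t\le e^{C_0/T}\,\mathbb E(\|y_0\|^2_{L^2(\mathcal D)}+\|z_0\|^2_{L^2(\mathcal D)})$. For $t\in[0,T]$, $X_t$ is the space of $(y,z)\in C([0,t];H^2(\mathcal D)\times H_0^1(\mathcal D))\cap L^2(0,t;H^4(\mathcal D)\times H^2(\mathcal D))$ with finite norm $$\|(y,z)\|_{X_t}=\Big(\sup_{0\le s\le t}\Big\|\tfrac{y(s)}{\hat\rho(s)}\Big\|^2_{H^2(\mathcal D)}+\sup_{0\le s\le t}\Big\|\tfrac{z(s)}{\hat\rho(s)}\Big\|^2_{H^1_0(\mathcal D)}+\int_0^t\Big\|\tfrac{y(s)}{\hat\rho(s)}\Big\|^2_{H^4(\mathcal D)}\mathrm{d}s+\int_0^t\Big\|\tfrac{z(s)}{\hat\rho(s)}\Big\|^2_{H^2(\mathcal D)}\mathrm{d}s\Big)^{1/2}.$$ For each $R>0$, $\varphi_R\in C_0^\infty(\mathbb R^+)$ is a cut-off function with $\varphi_R(s)=1$ if $s\le R$, $\varphi_R(s)=0$ if $s\ge 2R$, and $\|\varphi_R'\|_\infty\le C'/R$ with $C'$ independent of $R$. The truncated nonlinearity is, at time $t$, $f_R(y,y_x)=\varphi_R(\|(y,z)\|_{X_t})\,f(y,y_x)$, where $f(s,u)=su$ for $(s,u)\in\mathbb R^2$, so $f(y,y_x)=y\,y_x$.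 Property (TC), whose constant $C$ is used in the claim: there is a positive constant $C=C(\mathcal D,\mathcal D_0,b_1,b_2,b_3)$ such that for every $0<R\le e^{-C/T}$ and every $(y_0,z_0)\in L^2(\Omega,\mathcal F_0;H^2(\mathcal D)\cap H_0^1(\mathcal D))\times L^2(\Omega,\mathcal F_0;H_0^1(\mathcal D))$ there exists a control $h\in L^2_{\mathcal F}(0,T;L^2(\mathcal D))$ such that the solution $(y,z)$ of the system of the claim satisfies $\mathbb E(\|(y,z)\|_{X_T}^2)\le e^{2C/T}\,\mathbb E(\|y_0\|^2_{H^2(\mathcal D)\cap H_0^1(\mathcal D)}+\|z_0\|^2_{H_0^1(\mathcal D)})$ and $y(T,\cdot)=0$ in $\mathcal D$ a.s. The existence of such a $C$ is a theorem of the same work and may be assumed here. *)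

theory Defs
  imports "HOL-Probability.Probability"
begin

section \<open>Function spaces on the unit interval\<close>

abbreviation DD :: "real set" where
  "DD \<equiv> {0<..<1}"

text \<open>
  Elements of $L^2$ and of the Sobolev spaces are represented by functions, so the norms below are
  seminorms and equality in a space means equality almost everywhere.
  A function space is the pair of its carrier and its (semi)norm.
\<close>

type_synonym fspace = "(real \<Rightarrow> real) set \<times> ((real \<Rightarrow> real) \<Rightarrow> real)"

definition L2_fun :: "real set \<Rightarrow> (real \<Rightarrow> real) set" where
  "L2_fun S = {u. u \<in> borel_measurable (lebesgue_on S) \<and> integrable (lebesgue_on S) (\<lambda>x. (u x)\<^sup>2)}"

definition inner_L2 :: "real set \<Rightarrow> (real \<Rightarrow> real) \<Rightarrow> (real \<Rightarrow> real) \<Rightarrow> real" where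
  "inner_L2 S u v = (LINT x|lebesgue_on S. u x * v x)"

definition norm_L2 :: "real set \<Rightarrow> (real \<Rightarrow> real) \<Rightarrow> real" where
  "norm_L2 S u = sqrt (inner_L2 S u u)"

definition smooth :: "(real \<Rightarrow> real) \<Rightarrow> bool" where
  "smooth g \<longleftrightarrow> (\<forall>n x. (deriv ^^ n) g differentiable (at x))"

definition test_fun :: "(real \<Rightarrow> real) \<Rightarrow> bool" where
  "test_fun g \<longleftrightarrow> smooth g \<and> (\<exists>K. compact K \<and> K \<subseteq> DD \<and> (\<forall>x. x \<notin> K \<longrightarrow> g x = 0))"

definition has_weak_deriv :: "nat \<Rightarrow> (real \<Rightarrow> real) \<Rightarrow> (real \<Rightarrow> real) \<Rightarrow> bool" where
  "has_weak_deriv j u v \<longleftrightarrow>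
     (\<forall>g. test_fun g \<longrightarrow> inner_L2 DD u ((deriv ^^ j) g) = (- 1) ^ j * inner_L2 DD v g)"

definition wderiv :: "nat \<Rightarrow> (real \<Rightarrow> real) \<Rightarrow> real \<Rightarrow> real" where
  "wderiv j u = (SOME v. v \<in> L2_fun DD \<and> has_weak_deriv j u v)"

definition H_set :: "nat \<Rightarrow> (real \<Rightarrow> real) set" where
  "H_set k = {u \<in> L2_fun DD. \<forall>j\<le>k. \<exists>v\<in>L2_fun DD. has_weak_deriv j u v}"

definition norm_H :: "nat \<Rightarrow> (real \<Rightarrow> real) \<Rightarrow> real" where
  "norm_H k u = sqrt (\<Sum>j\<le>k. (norm_L2 DD (wderiv j u))\<^sup>2)"

text \<open>$H^1_0$ is the closure of the test functions in $H^1$, with the norm of $H^1$.\<close>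

definition H01_set :: "(real \<Rightarrow> real) set" where
  "H01_set = {u \<in> H_set 1. \<forall>e>0. \<exists>g. test_fun g \<and> norm_H 1 (\<lambda>x. u x - g x) < e}"

definition L2_sp :: "real set \<Rightarrow> fspace" where
  "L2_sp S = (L2_fun S, norm_L2 S)"

definition H_sp :: "nat \<Rightarrow> fspace" where
  "H_sp k = (H_set k, norm_H k)"

definition H01_sp :: fspace where
  "H01_sp = (H01_set, norm_H 1)"

definition H2_H01_sp :: fspace where
  "H2_H01_sp = (H_set 2 \<inter> H01_set, norm_H 2)"

definition fopen :: "fspace \<Rightarrow> (real \<Rightarrow> real) set \<Rightarrow> bool" where
  "fopen X U \<longleftrightarrow> U \<subseteq> fst X \<and>
     (\<forall>u\<in>U. \<exists>r>0. \<forall>v\<in>fst X. snd X (\<lambda>x. v x - u x) < r \<longrightarrow> v \<in> U)"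

definition fborel :: "fspace \<Rightarrow> (real \<Rightarrow> real) measure" where
  "fborel X = sigma (fst X) {U. fopen X U}"

text \<open>The squared norm, equal to $\infty$ outside the space.\<close>

definition esqnorm :: "fspace \<Rightarrow> (real \<Rightarrow> real) \<Rightarrow> ennreal" where
  "esqnorm X u = (if u \<in> fst X then ennreal ((snd X u)\<^sup>2) else \<infinity>)"

definition ennsqrt :: "ennreal \<Rightarrow> ennreal" where
  "ennsqrt a = (if a = \<infinity> then \<infinity> else ennreal (sqrt (enn2real a)))"


section \<open>Brownian motion and the It\^o integral\<close>

definition brownian_motion :: "'w measure \<Rightarrow> (real \<Rightarrow> 'w \<Rightarrow> real) \<Rightarrow> bool" where
  "brownian_motion M W \<longleftrightarrow>
     (\<forall>t\<ge>0. W t \<in> borel_measurable M) \<and>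
     (AE \<omega> in M. W 0 \<omega> = 0) \<and>
     (AE \<omega> in M. continuous_on {0..} (\<lambda>t. W t \<omega>)) \<and>
     (\<forall>s t. 0 \<le> s \<and> s < t \<longrightarrow>
        distributed M lborel (\<lambda>\<omega>. W t \<omega> - W s \<omega>) (normal_density 0 (sqrt (t - s)))) \<and>
     (\<forall>(\<tau> :: nat \<Rightarrow> real) n. 0 \<le> \<tau> 0 \<and> mono \<tau> \<longrightarrow>
        prob_space.indep_vars M (\<lambda>_. borel) (\<lambda>k \<omega>. W (\<tau> (Suc k)) \<omega> - W (\<tau> k) \<omega>) {..<n})"

text \<open>The natural filtration of \<open>W\<close> augmented by the null sets.\<close>

definition Filt :: "'w measure \<Rightarrow> (real \<Rightarrow> 'w \<Rightarrow> real) \<Rightarrow> real \<Rightarrow> 'w measure" where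
  "Filt M W t = sigma (space M)
     ({W s -` B \<inter> space M | s B. 0 \<le> s \<and> s \<le> t \<and> B \<in> sets borel} \<union> null_sets M)"

abbreviation time_prod :: "real \<Rightarrow> 'w measure \<Rightarrow> (real \<times> 'w) measure" where
  "time_prod T M \<equiv> restrict_space lborel {0..T} \<Otimes>\<^sub>M M"

definition step_process ::
  "nat \<Rightarrow> (nat \<Rightarrow> real) \<Rightarrow> (nat \<Rightarrow> 'w \<Rightarrow> real) \<Rightarrow> real \<Rightarrow> 'w \<Rightarrow> real" where
  "step_process n \<tau> \<xi> s \<omega> = (\<Sum>k<n. \<xi> k \<omega> * indicator {\<tau> k<..\<tau> (Suc k)} s)"

definition step_integral ::
  "(real \<Rightarrow> 'w \<Rightarrow> real) \<Rightarrow> nat \<Rightarrow> (nat \<Rightarrow> real) \<Rightarrow> (nat \<Rightarrow> 'w \<Rightarrow> real) \<Rightarrow> 'w \<Rightarrow> real" where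
  "step_integral W n \<tau> \<xi> \<omega> = (\<Sum>k<n. \<xi> k \<omega> * (W (\<tau> (Suc k)) \<omega> - W (\<tau> k) \<omega>))"

definition admissible_step ::
  "'w measure \<Rightarrow> (real \<Rightarrow> 'w \<Rightarrow> real) \<Rightarrow> real \<Rightarrow> nat \<Rightarrow> (nat \<Rightarrow> real) \<Rightarrow> (nat \<Rightarrow> 'w \<Rightarrow> real) \<Rightarrow> bool" where
  "admissible_step M W t n \<tau> \<xi> \<longleftrightarrow>
     0 \<le> \<tau> 0 \<and> mono \<tau> \<and> \<tau> n \<le> t \<and>
     (\<forall>k<n. \<xi> k \<in> borel_measurable (Filt M W (\<tau> k)) \<and> (\<exists>K. \<forall>\<omega>\<in>space M. \<bar>\<xi> k \<omega>\<bar> \<le> K))"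

text \<open>
  \<open>I\<close> is a version of $\int_0^t g\,\mathrm{d}W$: the $L^2(\Omega)$-limit of the integrals of simple
  adapted processes that converge to \<open>g\<close> in $L^2([0,t] \times \Omega)$.
\<close>

definition has_ito_integral ::
  "'w measure \<Rightarrow> (real \<Rightarrow> 'w \<Rightarrow> real) \<Rightarrow> real \<Rightarrow> (real \<Rightarrow> 'w \<Rightarrow> real) \<Rightarrow> ('w \<Rightarrow> real) \<Rightarrow> bool" where
  "has_ito_integral M W t g I \<longleftrightarrow>
     (\<lambda>(s, \<omega>). g s \<omega>) \<in> borel_measurable (time_prod t M) \<and>
     I \<in> borel_measurable M \<and>
     (\<exists>n \<tau> \<xi>.
        (\<forall>i::nat. admissible_step M W t (n i) (\<tau> i) (\<xi> i)) \<and>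
        (\<lambda>i. \<integral>\<^sup>+\<omega>. (\<integral>\<^sup>+s\<in>{0..t}. ennreal ((step_process (n i) (\<tau> i) (\<xi> i) s \<omega> - g s \<omega>)\<^sup>2) \<partial>lborel) \<partial>M)
          \<longlonglongrightarrow> 0 \<and>
        (\<lambda>i. \<integral>\<^sup>+\<omega>. ennreal ((step_integral W (n i) (\<tau> i) (\<xi> i) \<omega> - I \<omega>)\<^sup>2) \<partial>M) \<longlonglongrightarrow> 0)"


section \<open>Spaces of random variables and adapted processes\<close>

text \<open>$L^2(\Omega,\mathcal F_0;X)$\<close>

definition L2_F0 ::
  "'w measure \<Rightarrow> (real \<Rightarrow> 'w \<Rightarrow> real) \<Rightarrow> fspace \<Rightarrow> ('w \<Rightarrow> real \<Rightarrow> real) \<Rightarrow> bool" where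
  "L2_F0 M W X u \<longleftrightarrow> u \<in> Filt M W 0 \<rightarrow>\<^sub>M fborel X \<and> (\<integral>\<^sup>+\<omega>. esqnorm X (u \<omega>) \<partial>M) < \<infinity>"

text \<open>$L^2_{\mathcal F}(0,T;X)$\<close>

definition L2_F ::
  "'w measure \<Rightarrow> (real \<Rightarrow> 'w \<Rightarrow> real) \<Rightarrow> real \<Rightarrow> fspace \<Rightarrow> (real \<Rightarrow> 'w \<Rightarrow> real \<Rightarrow> real) \<Rightarrow> bool" where
  "L2_F M W T X u \<longleftrightarrow>
     (\<lambda>(t, \<omega>). u t \<omega>) \<in> time_prod T M \<rightarrow>\<^sub>M fborel X \<and>
     (\<forall>t\<in>{0..T}. u t \<in> Filt M W t \<rightarrow>\<^sub>M fborel X) \<and>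
     (\<integral>\<^sup>+\<omega>. (\<integral>\<^sup>+t\<in>{0..T}. esqnorm X (u t \<omega>) \<partial>lborel) \<partial>M) < \<infinity>"

text \<open>$L^2_{\mathcal F}(\Omega;C([0,T];X))$\<close>

definition L2_F_C ::
  "'w measure \<Rightarrow> (real \<Rightarrow> 'w \<Rightarrow> real) \<Rightarrow> real \<Rightarrow> fspace \<Rightarrow> (real \<Rightarrow> 'w \<Rightarrow> real \<Rightarrow> real) \<Rightarrow> bool" where
  "L2_F_C M W T X u \<longleftrightarrow>
     (\<forall>t\<in>{0..T}. u t \<in> Filt M W t \<rightarrow>\<^sub>M fborel X) \<and>
     (\<forall>\<omega>\<in>space M. \<forall>t\<in>{0..T}.
        ((\<lambda>s. snd X (\<lambda>x. u s \<omega> x - u t \<omega> x)) \<longlongrightarrow> 0) (at t within {0..T})) \<and>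
     (\<integral>\<^sup>+\<omega>. (SUP t\<in>{0..T}. esqnorm X (u t \<omega>)) \<partial>M) < \<infinity>"

text \<open>$L^\infty_{\mathcal F}(0,T;\mathbb R)$\<close>

definition Linf_F ::
  "'w measure \<Rightarrow> (real \<Rightarrow> 'w \<Rightarrow> real) \<Rightarrow> real \<Rightarrow> (real \<Rightarrow> 'w \<Rightarrow> real) \<Rightarrow> bool" where
  "Linf_F M W T b \<longleftrightarrow>
     (\<lambda>(t, \<omega>). b t \<omega>) \<in> borel_measurable (time_prod T M) \<and>
     (\<forall>t\<in>{0..T}. b t \<in> borel_measurable (Filt M W t)) \<and>
     (\<exists>K. AE (t, \<omega>) in time_prod T M. \<bar>b t \<omega>\<bar> \<le> K)"

text \<open>Membership in $L^2_{\mathcal F}(0,T;X)$ of a class modulo $\mathrm dt \otimes \mathbb P$-null sets.\<close>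

definition L2_F_ae ::
  "'w measure \<Rightarrow> (real \<Rightarrow> 'w \<Rightarrow> real) \<Rightarrow> real \<Rightarrow> fspace \<Rightarrow> (real \<Rightarrow> 'w \<Rightarrow> real \<Rightarrow> real) \<Rightarrow> bool" where
  "L2_F_ae M W T X u \<longleftrightarrow>
     (\<exists>v. L2_F M W T X v \<and>
        (AE (t, \<omega>) in time_prod T M. AE x in lebesgue_on DD. u t \<omega> x = v t \<omega> x))"


section \<open>The controlled system\<close>

text \<open>
  Variational solutions of
  \[ \mathrm dy + (y_{xxxx} + N)\,\mathrm dt = \chi_{D_0} h\,\mathrm dt + (b_1 y + b_2 z)\,\mathrm dW,
     \quad \mathrm dz - z_{xx}\,\mathrm dt = y\,\mathrm dt + b_3 z\,\mathrm dW \]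
  with $y = y_{xx} = 0$ and $z = 0$ on the boundary.
  The conditions $y = 0$ and $z = 0$ are carried by $H^1_0$; the condition $y_{xx} = 0$ is the natural
  boundary condition of the form $\int y_{xx} v_{xx}$ on $H^2 \cap H^1_0$, since
  $\int y_{xxxx} v = \int y_{xx} v_{xx} - [y_{xx} v_x]_0^1$ for $v \in H^2 \cap H^1_0$.
\<close>

definition weak_solution ::
  "'w measure \<Rightarrow> (real \<Rightarrow> 'w \<Rightarrow> real) \<Rightarrow> real set \<Rightarrow>
   (real \<Rightarrow> 'w \<Rightarrow> real) \<Rightarrow> (real \<Rightarrow> 'w \<Rightarrow> real) \<Rightarrow> (real \<Rightarrow> 'w \<Rightarrow> real) \<Rightarrow> real \<Rightarrow>
   ('w \<Rightarrow> real \<Rightarrow> real) \<Rightarrow> ('w \<Rightarrow> real \<Rightarrow> real) \<Rightarrow>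
   (real \<Rightarrow> 'w \<Rightarrow> real \<Rightarrow> real) \<Rightarrow> (real \<Rightarrow> 'w \<Rightarrow> real \<Rightarrow> real) \<Rightarrow>
   (real \<Rightarrow> 'w \<Rightarrow> real \<Rightarrow> real) \<Rightarrow> (real \<Rightarrow> 'w \<Rightarrow> real \<Rightarrow> real) \<Rightarrow> bool" where
  "weak_solution M W D0 b1 b2 b3 T y0 z0 h N y z \<longleftrightarrow>
     L2_F_C M W T (L2_sp DD) y \<and> L2_F_ae M W T H2_H01_sp y \<and>
     L2_F_C M W T (L2_sp DD) z \<and> L2_F_ae M W T H01_sp z \<and>
     (AE \<omega> in M. AE x in lebesgue_on DD. y 0 \<omega> x = y0 \<omega> x \<and> z 0 \<omega> x = z0 \<omega> x) \<and>
     (\<forall>v\<in>fst H2_H01_sp. \<forall>t\<in>{0..T}.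
        has_ito_integral M W t
          (\<lambda>s \<omega>. b1 s \<omega> * inner_L2 DD (y s \<omega>) v + b2 s \<omega> * inner_L2 DD (z s \<omega>) v)
          (\<lambda>\<omega>. inner_L2 DD (y t \<omega>) v - inner_L2 DD (y0 \<omega>) v
             + (LINT s:{0..t}|lebesgue.
                  inner_L2 DD (wderiv 2 (y s \<omega>)) (wderiv 2 v) + inner_L2 DD (N s \<omega>) v
                  - inner_L2 DD (\<lambda>x. indicator D0 x * h s \<omega> x) v))) \<and>
     (\<forall>v\<in>fst H01_sp. \<forall>t\<in>{0..T}.
        has_ito_integral M W t
          (\<lambda>s \<omega>. b3 s \<omega> * inner_L2 DD (z s \<omega>) v)
          (\<lambda>\<omega>. inner_L2 DD (z t \<omega>) v - inner_L2 DD (z0 \<omega>) v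
             + (LINT s:{0..t}|lebesgue.
                  inner_L2 DD (wderiv 1 (z s \<omega>)) (wderiv 1 v) - inner_L2 DD (y s \<omega>) v)))"

text \<open>\<open>(y, z)\<close> is, up to indistinguishability, the only pair of processes with the property \<open>S\<close>.\<close>

definition is_the_solution ::
  "'w measure \<Rightarrow> real \<Rightarrow>
   ((real \<Rightarrow> 'w \<Rightarrow> real \<Rightarrow> real) \<Rightarrow> (real \<Rightarrow> 'w \<Rightarrow> real \<Rightarrow> real) \<Rightarrow> bool) \<Rightarrow>
   (real \<Rightarrow> 'w \<Rightarrow> real \<Rightarrow> real) \<Rightarrow> (real \<Rightarrow> 'w \<Rightarrow> real \<Rightarrow> real) \<Rightarrow> bool" where
  "is_the_solution M T S y z \<longleftrightarrow>
     S y z \<and>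
     (\<forall>y' z'. S y' z' \<longrightarrow>
        (AE \<omega> in M. \<forall>t\<in>{0..T}. AE x in lebesgue_on DD. y' t \<omega> x = y t \<omega> x \<and> z' t \<omega> x = z t \<omega> x))"

definition vanishes_at ::
  "'w measure \<Rightarrow> real \<Rightarrow> (real \<Rightarrow> 'w \<Rightarrow> real \<Rightarrow> real) \<Rightarrow> bool" where
  "vanishes_at M T y \<longleftrightarrow> (AE \<omega> in M. AE x in lebesgue_on DD. y T \<omega> x = 0)"

text \<open>The property of the constant $C_0$: null controllability of the linear system at cost $e^{C_0/T}$.\<close>

definition linear_null_control_cost ::
  "'w measure \<Rightarrow> (real \<Rightarrow> 'w \<Rightarrow> real) \<Rightarrow> real set \<Rightarrow>
   (real \<Rightarrow> 'w \<Rightarrow> real) \<Rightarrow> (real \<Rightarrow> 'w \<Rightarrow> real) \<Rightarrow> (real \<Rightarrow> 'w \<Rightarrow> real) \<Rightarrow> real \<Rightarrow> bool" where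
  "linear_null_control_cost M W D0 b1 b2 b3 C0 \<longleftrightarrow>
     (\<forall>T>0. \<forall>y0 z0. L2_F0 M W (L2_sp DD) y0 \<and> L2_F0 M W (L2_sp DD) z0 \<longrightarrow>
        (\<exists>h y z.
           L2_F M W T (L2_sp D0) h \<and>
           is_the_solution M T (weak_solution M W D0 b1 b2 b3 T y0 z0 h (\<lambda>_ _ _. 0)) y z \<and>
           vanishes_at M T y \<and> vanishes_at M T z \<and>
           (\<integral>\<^sup>+\<omega>. (\<integral>\<^sup>+t\<in>{0..T}. esqnorm (L2_sp D0) (h t \<omega>) \<partial>lborel) \<partial>M)
             \<le> ennreal (exp (C0 / T)) *
               (\<integral>\<^sup>+\<omega>. esqnorm (L2_sp DD) (y0 \<omega>) + esqnorm (L2_sp DD) (z0 \<omega>) \<partial>M)))"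


section \<open>The weighted norm and the truncated system\<close>

definition rho_hat :: "real \<Rightarrow> real \<Rightarrow> real \<Rightarrow> real \<Rightarrow> real \<Rightarrow> real" where
  "rho_hat Mw \<zeta> Q T t = exp (- (Mw * \<zeta> / ((Q - 1) * (T - t))))"

text \<open>
  The squared norm of $X_t$, for a weight \<open>\<rho>\<close> on $[0,T)$. For $t = T$ the suprema are over
  $0 \le s < T$; finiteness then forces $y(s), z(s) \to 0$ as $s \to T$.
\<close>

definition X_sqnorm ::
  "(real \<Rightarrow> real) \<Rightarrow> real \<Rightarrow> real \<Rightarrow> (real \<Rightarrow> real \<Rightarrow> real) \<Rightarrow> (real \<Rightarrow> real \<Rightarrow> real) \<Rightarrow> ennreal" where
  "X_sqnorm \<rho> T t y z =
     (SUP s\<in>{0..t} \<inter> {0..<T}. esqnorm (H_sp 2) (\<lambda>x. y s x / \<rho> s)) +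
     (SUP s\<in>{0..t} \<inter> {0..<T}. esqnorm H01_sp (\<lambda>x. z s x / \<rho> s)) +
     (\<integral>\<^sup>+s\<in>{0..t} \<inter> {0..<T}. esqnorm (H_sp 4) (\<lambda>x. y s x / \<rho> s) \<partial>lborel) +
     (\<integral>\<^sup>+s\<in>{0..t} \<inter> {0..<T}. esqnorm (H_sp 2) (\<lambda>x. z s x / \<rho> s) \<partial>lborel)"

definition X_norm ::
  "(real \<Rightarrow> real) \<Rightarrow> real \<Rightarrow> real \<Rightarrow> (real \<Rightarrow> real \<Rightarrow> real) \<Rightarrow> (real \<Rightarrow> real \<Rightarrow> real) \<Rightarrow> ennreal" where
  "X_norm \<rho> T t y z = ennsqrt (X_sqnorm \<rho> T t y z)"

text \<open>
  \<open>\<phi> R\<close> is considered as a function on the whole line that is constant on $(-\infty, R]$; only its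
  values on $[0,\infty)$ are used.
\<close>

definition cutoff_family :: "(real \<Rightarrow> real \<Rightarrow> real) \<Rightarrow> bool" where
  "cutoff_family \<phi> \<longleftrightarrow>
     (\<forall>R>0. smooth (\<phi> R) \<and> (\<forall>s\<le>R. \<phi> R s = 1) \<and> (\<forall>s\<ge>2 * R. \<phi> R s = 0)) \<and>
     (\<exists>C'. \<forall>R>0. \<forall>s. \<bar>deriv (\<phi> R) s\<bar> \<le> C' / R)"

definition ff :: "real \<Rightarrow> real \<Rightarrow> real" where
  "ff s u = s * u"

text \<open>The cut-off vanishes where the $X_t$-norm is infinite.\<close>

definition f_trunc ::
  "(real \<Rightarrow> real) \<Rightarrow> real \<Rightarrow> (real \<Rightarrow> real \<Rightarrow> real) \<Rightarrow> real \<Rightarrow>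
   (real \<Rightarrow> 'w \<Rightarrow> real \<Rightarrow> real) \<Rightarrow> (real \<Rightarrow> 'w \<Rightarrow> real \<Rightarrow> real) \<Rightarrow> real \<Rightarrow> 'w \<Rightarrow> real \<Rightarrow> real" where
  "f_trunc \<rho> T \<phi> R y z t \<omega> x =
     (let a = X_norm \<rho> T t (\<lambda>s. y s \<omega>) (\<lambda>s. z s \<omega>)
      in (if a = \<infinity> then 0 else \<phi> R (enn2real a)) * ff (y t \<omega> x) (wderiv 1 (y t \<omega>) x))"

definition truncated_solution ::
  "'w measure \<Rightarrow> (real \<Rightarrow> 'w \<Rightarrow> real) \<Rightarrow> real set \<Rightarrow>
   (real \<Rightarrow> 'w \<Rightarrow> real) \<Rightarrow> (real \<Rightarrow> 'w \<Rightarrow> real) \<Rightarrow> (real \<Rightarrow> 'w \<Rightarrow> real) \<Rightarrow>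
   (real \<Rightarrow> real) \<Rightarrow> (real \<Rightarrow> real \<Rightarrow> real) \<Rightarrow> real \<Rightarrow> real \<Rightarrow>
   ('w \<Rightarrow> real \<Rightarrow> real) \<Rightarrow> ('w \<Rightarrow> real \<Rightarrow> real) \<Rightarrow> (real \<Rightarrow> 'w \<Rightarrow> real \<Rightarrow> real) \<Rightarrow>
   (real \<Rightarrow> 'w \<Rightarrow> real \<Rightarrow> real) \<Rightarrow> (real \<Rightarrow> 'w \<Rightarrow> real \<Rightarrow> real) \<Rightarrow> bool" where
  "truncated_solution M W D0 b1 b2 b3 \<rho> \<phi> R T y0 z0 h =
     is_the_solution M T
       (\<lambda>y z. L2_F_C M W T (H_sp 2) y \<and> L2_F_C M W T H01_sp z \<and>
          weak_solution M W D0 b1 b2 b3 T y0 z0 h (f_trunc \<rho> T \<phi> R y z) y z)"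

text \<open>
  Property (TC) for the horizon \<open>T\<close>. The first conjunct about the $X_T$-norm says that it is a random
  variable, so that its second moment makes sense.
\<close>

definition truncated_controllability ::
  "'w measure \<Rightarrow> (real \<Rightarrow> 'w \<Rightarrow> real) \<Rightarrow> real set \<Rightarrow>
   (real \<Rightarrow> 'w \<Rightarrow> real) \<Rightarrow> (real \<Rightarrow> 'w \<Rightarrow> real) \<Rightarrow> (real \<Rightarrow> 'w \<Rightarrow> real) \<Rightarrow>
   (real \<Rightarrow> real) \<Rightarrow> (real \<Rightarrow> real \<Rightarrow> real) \<Rightarrow> real \<Rightarrow> real \<Rightarrow> bool" where
  "truncated_controllability M W D0 b1 b2 b3 \<rho> \<phi> T C \<longleftrightarrow>
     (\<forall>R y0 z0. 0 < R \<and> R \<le> exp (- C / T) \<and> L2_F0 M W H2_H01_sp y0 \<and> L2_F0 M W H01_sp z0 \<longrightarrow>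
        (\<exists>h y z.
           L2_F M W T (L2_sp DD) h \<and>
           truncated_solution M W D0 b1 b2 b3 \<rho> \<phi> R T y0 z0 h y z \<and>
           (\<lambda>\<omega>. X_norm \<rho> T T (\<lambda>s. y s \<omega>) (\<lambda>s. z s \<omega>)) \<in> borel_measurable M \<and>
           (\<integral>\<^sup>+\<omega>. (X_norm \<rho> T T (\<lambda>s. y s \<omega>) (\<lambda>s. z s \<omega>))\<^sup>2 \<partial>M)
             \<le> ennreal (exp (2 * C / T)) *
               (\<integral>\<^sup>+\<omega>. esqnorm H2_H01_sp (y0 \<omega>) + esqnorm H01_sp (z0 \<omega>) \<partial>M) \<and>
           vanishes_at M T y))"

end

theory Submission
  imports Defs
begin

text \<open>
  Take the control and the solution given by (TC) for $R = e^{-C/T}$. The $X_t$-norm is nondecreasing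
  in \<open>t\<close>, so its supremum over $[0,T]$ is the $X_T$-norm, and Markov's inequality bounds the
  probability that this norm exceeds \<open>R\<close> by
  $R^{-2}\, e^{2C/T}\, \delta^2 = \epsilon$.
  The control enters the equation only through its values on $\mathcal D_0$.
\<close>

text \<open>The distance on a function space is the norm of a difference, so the monotonicity of
  \<open>norm_L2\<close> below has to be applied to differences.\<close>

lemma L2_fun_diff:
  assumes "u \<in> L2_fun S" "v \<in> L2_fun S"
  shows "(\<lambda>x. u x - v x) \<in> L2_fun S"
proof -
  have [measurable]: "u \<in> borel_measurable (lebesgue_on S)" "v \<in> borel_measurable (lebesgue_on S)"
    using assms by (auto simp: L2_fun_def)
  have "integrable (lebesgue_on S) (\<lambda>x. 2 * (u x)\<^sup>2 + 2 * (v x)\<^sup>2)"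
    using assms by (auto simp: L2_fun_def)
  then have "integrable (lebesgue_on S) (\<lambda>x. (u x - v x)\<^sup>2)"
  proof (rule Bochner_Integration.integrable_bound)
    \<comment> \<open>The right side minus the left side is the square of
      \<open>u x + v x\<close>.\<close>
    have "(u x - v x)\<^sup>2 \<le> 2 * (u x)\<^sup>2 + 2 * (v x)\<^sup>2" for x
      using zero_le_power2[of "u x + v x"] by (simp add: power2_eq_square algebra_simps)
    then show "AE x in lebesgue_on S. norm ((u x - v x)\<^sup>2) \<le> norm (2 * (u x)\<^sup>2 + 2 * (v x)\<^sup>2)"
      by simp
  qed measurable
  then show ?thesis by (simp add: L2_fun_def)
qed

lemma L2_fun_subset:
  assumes "S \<in> sets lebesgue" "S' \<in> sets lebesgue" "S \<subseteq> S'" "u \<in> L2_fun S'"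
  shows "u \<in> L2_fun S"
proof -
  have "u \<in> borel_measurable (lebesgue_on S)"
    using assms by (auto simp: L2_fun_def intro: measurable_restrict_mono)
  moreover have "set_integrable lebesgue S' (\<lambda>x. (u x)\<^sup>2)"
    using assms by (simp add: L2_fun_def integrable_restrict_space set_integrable_def)
  then have "set_integrable lebesgue S (\<lambda>x. (u x)\<^sup>2)"
    using assms by (blast intro: set_integrable_subset)
  ultimately show ?thesis
    using assms by (simp add: L2_fun_def integrable_restrict_space set_integrable_def)
qed

lemma norm_L2_subset_mono:
  assumes "S \<in> sets lebesgue" "S' \<in> sets lebesgue" "S \<subseteq> S'" "u \<in> L2_fun S'"
  shows "norm_L2 S u \<le> norm_L2 S' u"
proof -
  have "set_integrable lebesgue S (\<lambda>x. (u x)\<^sup>2)" "set_integrable lebesgue S' (\<lambda>x. (u x)\<^sup>2)"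
    using assms L2_fun_subset[OF assms]
    by (simp_all add: L2_fun_def integrable_restrict_space set_integrable_def)
  then have "(LINT x:S|lebesgue. (u x)\<^sup>2) \<le> (LINT x:S'|lebesgue. (u x)\<^sup>2)"
    unfolding set_lebesgue_integral_def set_integrable_def
    using assms(3) by (intro integral_mono) (auto split: split_indicator)
  then show ?thesis
    using assms
    by (simp add: norm_L2_def inner_L2_def integral_restrict_space set_lebesgue_integral_def
        power2_eq_square)
qed

text \<open>A norm-decreasing inclusion is continuous, hence Borel. The preimage under it of a
  \<open>Y\<close>-open set is its trace on \<open>X\<close>, and checking generators of the
  sigma-algebra suffices.\<close>

lemma measurable_fborel_subspace:
  assumes sub: "fst X \<subseteq> fst Y"
    and contraction: "\<And>u v. u \<in> fst X \<Longrightarrow> v \<in> fst X \<Longrightarrow> snd Y (\<lambda>x. v x - u x) \<le> snd X (\<lambda>x. v x - u x)"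
  shows "(\<lambda>u. u) \<in> fborel X \<rightarrow>\<^sub>M fborel Y"
proof -
  have "fopen X (U \<inter> fst X)" if "fopen Y U" for U
    unfolding fopen_def
  proof (intro conjI ballI)
    fix u assume u: "u \<in> U \<inter> fst X"
    with that have "\<exists>r>0. \<forall>v\<in>fst Y. snd Y (\<lambda>x. v x - u x) < r \<longrightarrow> v \<in> U"
      unfolding fopen_def by (elim conjE) (drule bspec[of U _ u], simp_all)
    then obtain r where r: "r > 0" "\<forall>v\<in>fst Y. snd Y (\<lambda>x. v x - u x) < r \<longrightarrow> v \<in> U"
      by (elim exE conjE)
    \<comment> \<open>The radius valid in \<open>Y\<close> also works in \<open>X\<close>, since an
      \<open>X\<close>-ball lies in the \<open>Y\<close>-ball of the same radius.\<close>
    have "v \<in> U \<inter> fst X" if "v \<in> fst X" "snd X (\<lambda>x. v x - u x) < r" for v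
    proof -
      have "snd Y (\<lambda>x. v x - u x) < r"
        using contraction[of u v] u that by simp
      moreover have "v \<in> fst Y"
        using sub that(1) by (rule subsetD)
      ultimately show ?thesis
        using r(2) that(1) by simp
    qed
    then show "\<exists>r>0. \<forall>v\<in>fst X. snd X (\<lambda>x. v x - u x) < r \<longrightarrow> v \<in> U \<inter> fst X"
      using r(1) by (intro exI[of _ r]) simp
  qed simp
  moreover have "{U. fopen Z U} \<subseteq> Pow (fst Z)" for Z
    by (auto simp: fopen_def)
  ultimately show ?thesis
    unfolding fborel_def using sub
    by (intro measurable_measure_of) (auto simp: space_measure_of_conv sets_measure_of)
qed

text \<open>Outside \<open>X\<close> the right side is infinite, so the norms need comparing only on
  \<open>fst X\<close>.\<close>

lemma esqnorm_mono:
  assumes "u \<in> fst X \<Longrightarrow> u \<in> fst Y \<and> 0 \<le> snd Y u \<and> snd Y u \<le> snd X u"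
  shows "esqnorm Y u \<le> esqnorm X u"
  using assms by (auto simp: esqnorm_def intro!: ennreal_leI power_mono)

text \<open>The process itself is unchanged and only the target space grows: both measurability
  conditions follow by composition with the inclusion, the moment bound from
  \<open>esqnorm_mono\<close>.\<close>

lemma L2_F_subspace:
  assumes sub: "fst X \<subseteq> fst Y"
    and contraction: "\<And>u v. u \<in> fst X \<Longrightarrow> v \<in> fst X \<Longrightarrow> snd Y (\<lambda>x. v x - u x) \<le> snd X (\<lambda>x. v x - u x)"
    and norm: "\<And>u. u \<in> fst X \<Longrightarrow> 0 \<le> snd Y u \<and> snd Y u \<le> snd X u"
    and h: "L2_F M W T X h"
  shows "L2_F M W T Y h"
proof -
  have incl: "(\<lambda>u. u) \<in> fborel X \<rightarrow>\<^sub>M fborel Y"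
    using sub contraction by (rule measurable_fborel_subspace)
  have "esqnorm Y u \<le> esqnorm X u" for u
    using norm sub by (intro esqnorm_mono) auto
  then have "(\<integral>\<^sup>+\<omega>. (\<integral>\<^sup>+t\<in>{0..T}. esqnorm Y (h t \<omega>) \<partial>lborel) \<partial>M)
      \<le> (\<integral>\<^sup>+\<omega>. (\<integral>\<^sup>+t\<in>{0..T}. esqnorm X (h t \<omega>) \<partial>lborel) \<partial>M)"
    by (intro nn_integral_mono mult_right_mono) auto
  then have "(\<integral>\<^sup>+\<omega>. (\<integral>\<^sup>+t\<in>{0..T}. esqnorm Y (h t \<omega>) \<partial>lborel) \<partial>M) < \<infinity>"
    using h unfolding L2_F_def by (elim conjE) (rule le_less_trans)
  moreover have "(\<lambda>(t, \<omega>). h t \<omega>) \<in> time_prod T M \<rightarrow>\<^sub>M fborel Y"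
    using measurable_compose[OF _ incl, of "\<lambda>(t, \<omega>). h t \<omega>" "time_prod T M"] h
    by (simp add: L2_F_def)
  moreover have "h t \<in> Filt M W t \<rightarrow>\<^sub>M fborel Y" if "t \<in> {0..T}" for t
    using measurable_compose[OF _ incl, of "h t" "Filt M W t"] h that
    by (simp add: L2_F_def)
  ultimately show ?thesis
    unfolding L2_F_def by blast
qed

text \<open>Elements are functions on the whole line, so restriction to \<open>S\<close> is the
  identity on representatives; it lowers the norm because the integrand \<open>(u x)\<^sup>2\<close>
  is nonnegative.\<close>

lemma L2_F_restrict_L2_sp:
  assumes "S \<in> sets lebesgue" "S' \<in> sets lebesgue" "S \<subseteq> S'" "L2_F M W T (L2_sp S') h"
  shows "L2_F M W T (L2_sp S) h"
proof (rule L2_F_subspace[OF _ _ _ assms(4)])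
  show "fst (L2_sp S') \<subseteq> fst (L2_sp S)"
    using L2_fun_subset[OF assms(1-3)] by (auto simp: L2_sp_def)
  show "snd (L2_sp S) (\<lambda>x. v x - u x) \<le> snd (L2_sp S') (\<lambda>x. v x - u x)"
    if "u \<in> fst (L2_sp S')" "v \<in> fst (L2_sp S')" for u v
    using that norm_L2_subset_mono[OF assms(1-3) L2_fun_diff] by (simp add: L2_sp_def)
  show "0 \<le> snd (L2_sp S) u \<and> snd (L2_sp S) u \<le> snd (L2_sp S') u"
    if "u \<in> fst (L2_sp S')" for u
    using that norm_L2_subset_mono[OF assms(1-3)]
    by (simp add: L2_sp_def norm_L2_def inner_L2_def)
qed

lemma ennsqrt_mono: "a \<le> b \<Longrightarrow> ennsqrt a \<le> ennsqrt b"
  by (auto simp: ennsqrt_def top_unique less_top intro!: ennreal_leI enn2real_mono)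

lemma le_power2_of_ennsqrt_le:
  assumes "ennsqrt a \<le> ennreal d" "0 \<le> d"
  shows "a \<le> ennreal (d\<^sup>2)"
\<comment> \<open>An infinite \<open>a\<close> would make \<open>ennsqrt a\<close> infinite, against
  the finite bound \<open>d\<close>.\<close>
proof (cases a)
  case (real r)
  with assms have "sqrt r \<le> d"
    by (simp add: ennsqrt_def)
  then have "r \<le> d\<^sup>2"
    using real(1) assms(2) by (simp add: real_sqrt_le_iff real_le_lsqrt sqrt_le_D)
  with real show ?thesis by (simp add: ennreal_leI)
qed (use assms in \<open>simp add: ennsqrt_def top_unique\<close>)

text \<open>Each of the four terms is a supremum or an integral of a nonnegative quantity over
  \<open>{0..t} \<inter> {0..<T}\<close>, a set that grows with \<open>t\<close>.\<close>

lemma X_sqnorm_mono: "t \<le> t' \<Longrightarrow> X_sqnorm \<rho> T t y z \<le> X_sqnorm \<rho> T t' y z"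
  unfolding X_sqnorm_def
  by (intro add_mono SUP_subset_mono nn_integral_mono) (auto split: split_indicator)

lemma SUP_X_norm:
  assumes "0 \<le> T"
  shows "(SUP t\<in>{0..T}. X_norm \<rho> T t y z) = X_norm \<rho> T T y z"
  using assms
  by (intro antisym SUP_least SUP_upper) (auto simp: X_norm_def intro!: ennsqrt_mono X_sqnorm_mono)

text \<open>Chebyshev's inequality, stated for \<open>ennreal\<close> values because the weighted
  norm may be infinite.\<close>

lemma (in prob_space) prob_le_of_second_moment:
  fixes X :: "'a \<Rightarrow> ennreal"
  assumes [measurable]: "X \<in> borel_measurable M"
    and "0 < R" "0 \<le> \<epsilon>"
    and moment: "(\<integral>\<^sup>+\<omega>. (X \<omega>)\<^sup>2 \<partial>M) \<le> ennreal (R\<^sup>2 * \<epsilon>)"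
  shows "1 - \<epsilon> \<le> \<P>(\<omega> in M. X \<omega> \<le> ennreal R)"
proof -
  let ?c = "ennreal (1 / R\<^sup>2)"
  let ?A = "{\<omega> \<in> space M. \<not> X \<omega> \<le> ennreal R}"
  \<comment> \<open>Scaling by \<open>?c\<close> brings the event into the form
    \<open>1 \<le> c * u\<close> of Markov's inequality; \<open>0 < R\<close> gives
    \<open>?c * R\<^sup>2 = 1\<close>.\<close>
  have "1 \<le> ?c * (X \<omega>)\<^sup>2" if "\<not> X \<omega> \<le> ennreal R" for \<omega>
  proof -
    have "?c * (ennreal R)\<^sup>2 \<le> ?c * (X \<omega>)\<^sup>2"
      using that by (intro mult_left_mono power_mono) auto
    then show ?thesis
      using assms(2) by (simp add: ennreal_power ennreal_mult[symmetric])
  qed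
  then have "emeasure M ?A \<le> emeasure M ({\<omega> \<in> space M. 1 \<le> ?c * (X \<omega>)\<^sup>2})"
    by (intro emeasure_mono) auto
  also have "\<dots> \<le> ?c * (\<integral>\<^sup>+\<omega>. (X \<omega>)\<^sup>2 * indicator (space M) \<omega> \<partial>M)"
    using nn_integral_Markov_inequality[of "\<lambda>\<omega>. (X \<omega>)\<^sup>2" "space M" M ?c]
    by (simp add: Int_def conj_commute)
  also have "(\<integral>\<^sup>+\<omega>. (X \<omega>)\<^sup>2 * indicator (space M) \<omega> \<partial>M) = (\<integral>\<^sup>+\<omega>. (X \<omega>)\<^sup>2 \<partial>M)"
    by (intro nn_integral_cong) simp
  also have "?c * \<dots> \<le> ?c * ennreal (R\<^sup>2 * \<epsilon>)"
    by (intro mult_left_mono moment) simp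
  also have "\<dots> = ennreal \<epsilon>"
    using assms(2,3) by (simp add: ennreal_mult[symmetric])
  finally have "prob ?A \<le> \<epsilon>"
    using assms(3) by (simp add: emeasure_eq_measure)
  then show ?thesis
    by (subst (asm) prob_neg) auto
qed

theorem theorem1p4:
  fixes M :: "'w measure" and W b1 b2 b3 :: "real \<Rightarrow> 'w \<Rightarrow> real" and D0 :: "real set"
    and Q P \<zeta> Mw C0 C T R \<epsilon> \<delta> :: real
    and \<phi> :: "real \<Rightarrow> real \<Rightarrow> real"
    and y0 z0 :: "'w \<Rightarrow> real \<Rightarrow> real"
  assumes "prob_space M" and "complete_measure M" and "brownian_motion M W"
    and "open D0" and "D0 \<noteq> {}" and "D0 \<subseteq> DD"
    and "\<And>T'. T' > 0 \<Longrightarrow> Linf_F M W T' b1 \<and> Linf_F M W T' b2 \<and> Linf_F M W T' b3"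
    and "1 < Q" and "Q < sqrt 2" and "P > Q\<^sup>2 / (2 - Q\<^sup>2)"
    and "(1 + P) * Q\<^sup>2 / 2 < \<zeta>" and "\<zeta> < P"
    and "C0 > 0" and "linear_null_control_cost M W D0 b1 b2 b3 C0" and "Mw \<ge> C0"
    and "cutoff_family \<phi>"
    and "\<epsilon> > 0" and "T > 0"
    and "C > 0" and "truncated_controllability M W D0 b1 b2 b3 (rho_hat Mw \<zeta> Q T) \<phi> T C"
    and "R = exp (- C / T)" and "\<delta> = exp (- 2 * C / T) * sqrt \<epsilon>"
    and "L2_F0 M W H2_H01_sp y0" and "L2_F0 M W H01_sp z0"
    and "ennsqrt (\<integral>\<^sup>+\<omega>. esqnorm H2_H01_sp (y0 \<omega>) + esqnorm H01_sp (z0 \<omega>) \<partial>M) \<le> ennreal \<delta>"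
  shows "\<exists>h y z.
      L2_F M W T (L2_sp D0) h \<and>
      truncated_solution M W D0 b1 b2 b3 (rho_hat Mw \<zeta> Q T) \<phi> R T y0 z0 h y z \<and>
      vanishes_at M T y \<and>
      \<P>(\<omega> in M. (SUP t\<in>{0..T}. X_norm (rho_hat Mw \<zeta> Q T) T t (\<lambda>s. y s \<omega>) (\<lambda>s. z s \<omega>)) \<le> ennreal R)
        \<ge> 1 - \<epsilon>"
proof -
  interpret prob_space M by fact
  let ?\<rho> = "rho_hat Mw \<zeta> Q T"
  let ?I = "\<integral>\<^sup>+\<omega>. esqnorm H2_H01_sp (y0 \<omega>) + esqnorm H01_sp (z0 \<omega>) \<partial>M"
  \<comment> \<open>This \<open>R\<close> is the largest truncation level that (TC) admits.\<close>
  have "0 < R \<and> R \<le> exp (- C / T) \<and> L2_F0 M W H2_H01_sp y0 \<and> L2_F0 M W H01_sp z0"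
    using assms(21,23,24) by simp
  then obtain h y z where h: "L2_F M W T (L2_sp DD) h"
    and sol: "truncated_solution M W D0 b1 b2 b3 ?\<rho> \<phi> R T y0 z0 h y z"
    and meas: "(\<lambda>\<omega>. X_norm ?\<rho> T T (\<lambda>s. y s \<omega>) (\<lambda>s. z s \<omega>)) \<in> borel_measurable M"
    and bound: "(\<integral>\<^sup>+\<omega>. (X_norm ?\<rho> T T (\<lambda>s. y s \<omega>) (\<lambda>s. z s \<omega>))\<^sup>2 \<partial>M) \<le> ennreal (exp (2 * C / T)) * ?I"
    and van: "vanishes_at M T y"
    using assms(20) unfolding truncated_controllability_def by blast
  have "D0 \<in> sets lebesgue" "DD \<in> sets lebesgue"
    using \<open>open D0\<close> by auto
  \<comment> \<open>The control is kept as it is, not multiplied by the indicator of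
    \<open>D0\<close>, so \<open>sol\<close> applies verbatim: the equation already contains that
    factor.\<close>
  then have h': "L2_F M W T (L2_sp D0) h"
    using \<open>D0 \<subseteq> DD\<close> h by (rule L2_F_restrict_L2_sp)
  have "?I \<le> ennreal (\<delta>\<^sup>2)"
    using assms(17,22,25) by (intro le_power2_of_ennsqrt_le) auto
  then have "ennreal (exp (2 * C / T)) * ?I \<le> ennreal (exp (2 * C / T)) * ennreal (\<delta>\<^sup>2)"
    by (intro mult_left_mono) simp_all
  also have "\<dots> = ennreal (exp (2 * C / T) * \<delta>\<^sup>2)"
    by (simp add: ennreal_mult)
  \<comment> \<open>In \<open>\<delta>\<^sup>2\<close> the exponential is
    \<open>exp (-4 * C / T)\<close>: one half cancels the cost \<open>exp (2 * C / T)\<close>, the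
    other half is \<open>R\<^sup>2\<close>.\<close>
  also have "exp (2 * C / T) * \<delta>\<^sup>2 = R\<^sup>2 * \<epsilon>"
    using assms(17,21,22)
    by (simp add: power_mult_distrib flip: exp_double exp_add)
  finally have "1 - \<epsilon> \<le> \<P>(\<omega> in M. X_norm ?\<rho> T T (\<lambda>s. y s \<omega>) (\<lambda>s. z s \<omega>) \<le> ennreal R)"
    using bound meas assms(17,21) by (intro prob_le_of_second_moment) auto
  then show ?thesis
    using h' sol van \<open>T > 0\<close> by (auto simp: SUP_X_norm)
qed

end
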